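(* For every harmonic map $F:\mathbb D\to\mathbb D^n$ with $F(0)=0$, $$\|dF_0\|\le\frac{4\sqrt n}{\pi},$$ and the constant is sharp.
   Context: $\mathbb D=\{z\in\mathbb C:|z|<1\}$. Harmonic maps into $\mathbb C^n\simeq\mathbb R^{2n}$ are understood componentwise. $\|dF_0\|$ is the operator norm of the real differential $dF_0:\mathbb R^2\to\mathbb R^{2n}$ for the Euclidean norms. Sharp means that the supremum of $\|dF_0\|$ over all such $F$ equals $4\sqrt n/\pi$. *)

theory Defs
  imports "HOL-Analysis.Analysis"
begin

text \<open>
  Real-valued harmonic functions on an open subset of the plane: \<open>u\<close> is of class \<open>C\<^sup>2\<close>, with first
  and second real Frechet derivatives \<open>Du\<close> and \<open>D2u\<close>, and \<open>u\<^sub>x\<^sub>x + u\<^sub>y\<^sub>y = 0\<close>.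
  The coordinate directions \<open>x\<close> and \<open>y\<close> are \<open>1\<close> and \<open>\<i>\<close>.
\<close>
definition harmonic_on :: "(complex \<Rightarrow> real) \<Rightarrow> complex set \<Rightarrow> bool" where
  "harmonic_on u S \<longleftrightarrow> open S \<and>
     (\<exists>(Du :: complex \<Rightarrow> complex \<Rightarrow>\<^sub>L real) (D2u :: complex \<Rightarrow> complex \<Rightarrow>\<^sub>L complex \<Rightarrow>\<^sub>L real).
        (\<forall>z\<in>S. (u has_derivative blinfun_apply (Du z)) (at z)) \<and>
        (\<forall>z\<in>S. (Du has_derivative blinfun_apply (D2u z)) (at z)) \<and>
        continuous_on S D2u \<and>
        (\<forall>z\<in>S. blinfun_apply (blinfun_apply (D2u z) 1) 1
             + blinfun_apply (blinfun_apply (D2u z) \<i>) \<i> = 0))"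

definition harmonic_map_on :: "(complex \<Rightarrow> complex ^ 'n) \<Rightarrow> complex set \<Rightarrow> bool" where
  "harmonic_map_on F S \<longleftrightarrow>
     (\<forall>i. harmonic_on (\<lambda>z. Re (F z $ i)) S \<and> harmonic_on (\<lambda>z. Im (F z $ i)) S)"

definition polydisc :: "(complex ^ 'n) set" where
  "polydisc = {w. \<forall>i. w $ i \<in> ball 0 1}"

text \<open>
  Only the values of \<open>F\<close> on the unit disc are constrained; the total function \<open>F\<close> is arbitrary elsewhere.
\<close>
definition centred_harmonic_maps :: "(complex \<Rightarrow> complex ^ 'n) set" where
  "centred_harmonic_maps =
     {F. harmonic_map_on F (ball 0 1) \<and> F ` ball 0 1 \<subseteq> polydisc \<and> F 0 = 0}"

end

theory Submission
  imports Defs "HOL-Complex_Analysis.Conformal_Mappings"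
begin

text \<open>
  On the disc a real harmonic function \<open>u\<close> is \<open>Re g\<close> with \<open>g\<close> holomorphic, because \<open>u\<^sub>x - \<i> u\<^sub>y\<close> satisfies
  the Cauchy-Riemann equations and so has a primitive. If \<open>\<bar>u\<bar> < 1\<close> and \<open>u 0 = 0\<close>, the Schwarz lemma
  applied to \<open>g\<close> followed by the conformal map \<open>w \<mapsto> (e\<^sup>i\<^sup>\<pi>\<^sup>w\<^sup>/\<^sup>2 - 1) / (e\<^sup>i\<^sup>\<pi>\<^sup>w\<^sup>/\<^sup>2 + 1)\<close> of the strip
  \<open>\<bar>Re w\<bar> < 1\<close> onto the disc gives \<open>\<bar>g' 0\<bar> \<le> 4/\<pi>\<close>. For a complex component \<open>f\<close>, applying this to the
  rotation of \<open>f\<close> that makes \<open>df\<^sub>0 v\<close> real and nonnegative bounds \<open>\<bar>df\<^sub>0 v\<bar>\<close> by \<open>4\<bar>v\<bar>/\<pi>\<close>, and summing the squares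
  of the components produces the factor \<open>\<surd>n\<close>. Equality holds when every component is
  \<open>Re (4/\<pi> Arctan z)\<close>.
\<close>

section \<open>Symmetry of second derivatives\<close>

text \<open>Two applications of the mean value theorem, first along \<open>v\<close> and then along
  \<open>w\<close>, each producing one factor \<open>h\<close>. This order of application fixes the
  order of the arguments \<open>w v\<close> of \<open>D2f\<close>.\<close>

lemma second_difference_mvt:
  fixes f :: "'a::real_normed_vector \<Rightarrow> real"
  assumes Df: "\<And>x. x \<in> S \<Longrightarrow> (f has_derivative blinfun_apply (Df x)) (at x)"
    and D2f: "\<And>x. x \<in> S \<Longrightarrow> (Df has_derivative blinfun_apply (D2f x)) (at x)"
    and "h > 0"
    and S: "\<And>s t. s \<in> {0..h} \<Longrightarrow> t \<in> {0..h} \<Longrightarrow> z + s *\<^sub>R v + t *\<^sub>R w \<in> S"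
  obtains s t where "s \<in> {0..h}" "t \<in> {0..h}"
    "f (z + h *\<^sub>R v + h *\<^sub>R w) - f (z + h *\<^sub>R v) - f (z + h *\<^sub>R w) + f z
       = h\<^sup>2 * D2f (z + s *\<^sub>R v + t *\<^sub>R w) w v"
proof -
  \<comment> \<open>\<open>\<phi>\<close> is the increment in direction \<open>w\<close> as a
    function of the position along \<open>v\<close>; the second difference is
    \<open>\<phi> h - \<phi> 0\<close>.\<close>
  define \<phi> where "\<phi> s = f (z + s *\<^sub>R v + h *\<^sub>R w) - f (z + s *\<^sub>R v)" for s
  define \<phi>' where "\<phi>' s = (\<lambda>x. x * (Df (z + s *\<^sub>R v + h *\<^sub>R w) v - Df (z + s *\<^sub>R v) v))" for s
  have "(\<phi> has_derivative \<phi>' s) (at s within {0..h})" if s: "0 \<le> s" "s \<le> h" for s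
  proof -
    have 1: "((\<lambda>s. f (z + s *\<^sub>R v + t *\<^sub>R w)) has_derivative (\<lambda>x. x * Df (z + s *\<^sub>R v + t *\<^sub>R w) v))
        (at s within {0..h})" if "t \<in> {0..h}" for t
    proof -
      have "((\<lambda>s. z + s *\<^sub>R v + t *\<^sub>R w) has_derivative (\<lambda>x. x *\<^sub>R v)) (at s within {0..h})"
        by (auto intro!: derivative_eq_intros)
      from has_derivative_compose[OF this Df[OF S]] show ?thesis
        using s that by (simp add: blinfun.scaleR_right)
    qed
    show ?thesis
      unfolding \<phi>_def \<phi>'_def
      using has_derivative_diff[OF 1[of h] 1[of 0]] \<open>h > 0\<close> by (simp add: algebra_simps)
  qed
  then obtain s where s: "s \<in> {0<..<h}" "\<phi> h - \<phi> 0 = \<phi>' s (h - 0)"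
    using mvt_simple[OF \<open>h > 0\<close>, of \<phi> \<phi>'] by auto
  define \<psi> where "\<psi> t = Df (z + s *\<^sub>R v + t *\<^sub>R w) v" for t
  define \<psi>' where "\<psi>' t = (\<lambda>x. x * D2f (z + s *\<^sub>R v + t *\<^sub>R w) w v)" for t
  have "(\<psi> has_derivative \<psi>' t) (at t within {0..h})" if t: "0 \<le> t" "t \<le> h" for t
  proof -
    have "((\<lambda>t. z + s *\<^sub>R v + t *\<^sub>R w) has_derivative (\<lambda>x. x *\<^sub>R w)) (at t within {0..h})"
      by (auto intro!: derivative_eq_intros)
    from has_derivative_compose[OF this D2f[OF S]]
    have "((\<lambda>t. Df (z + s *\<^sub>R v + t *\<^sub>R w)) has_derivative
        (\<lambda>x. x *\<^sub>R D2f (z + s *\<^sub>R v + t *\<^sub>R w) w)) (at t within {0..h})"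
      using s t by (simp add: blinfun.scaleR_right)
    then show ?thesis
      unfolding \<psi>_def \<psi>'_def
      by (auto intro!: derivative_eq_intros simp: blinfun.scaleR_left)
  qed
  then obtain t where t: "t \<in> {0<..<h}" "\<psi> h - \<psi> 0 = \<psi>' t (h - 0)"
    using mvt_simple[OF \<open>h > 0\<close>, of \<psi> \<psi>'] by auto
  show ?thesis
  proof
    show "f (z + h *\<^sub>R v + h *\<^sub>R w) - f (z + h *\<^sub>R v) - f (z + h *\<^sub>R w) + f z
       = h\<^sup>2 * D2f (z + s *\<^sub>R v + t *\<^sub>R w) w v"
      using s(2) t(2) by (simp add: \<phi>_def \<phi>'_def \<psi>_def \<psi>'_def power2_eq_square)
  qed (use s t in auto)
qed

text \<open>
  Both orders of the mixed derivative are limits of one second difference quotient, which is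
  symmetric in \<open>v\<close> and \<open>w\<close>.
\<close>

lemma second_derivative_commute:
  fixes f :: "'a::real_normed_vector \<Rightarrow> real"
  assumes Df: "\<And>x. x \<in> S \<Longrightarrow> (f has_derivative blinfun_apply (Df x)) (at x)"
    and D2f: "\<And>x. x \<in> S \<Longrightarrow> (Df has_derivative blinfun_apply (D2f x)) (at x)"
    and cont: "continuous_on S D2f" and S: "open S" "z \<in> S"
  shows "D2f z v w = D2f z w v"
proof (rule ccontr)
  assume ne: "D2f z v w \<noteq> D2f z w v"
  \<comment> \<open>Half the gap: one number closer than \<open>e\<close> to both mixed derivatives
    contradicts the triangle inequality.\<close>
  define e where "e = dist (D2f z v w) (D2f z w v) / 2"
  have "e > 0" using ne by (simp add: e_def)
  have "isCont D2f z"
    using cont S by (simp add: continuous_on_eq_continuous_at)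
  then have "(\<lambda>p. D2f p a b) \<midarrow>z\<rightarrow> D2f z a b" for a b
    by (intro tendsto_intros) (simp_all add: isCont_def)
  then have c: "((\<lambda>p. D2f p a b) \<longlongrightarrow> D2f z a b) (nhds z)" for a b
    by (rule tendsto_at_iff_tendsto_nhds[of "\<lambda>p. D2f p a b", THEN iffD1])
  have "\<forall>\<^sub>F p in nhds z. p \<in> S \<and> dist (D2f p v w) (D2f z v w) < e \<and> dist (D2f p w v) (D2f z w v) < e"
    using c[of v w] c[of w v] \<open>e > 0\<close> S
    by (auto intro!: eventually_conj eventually_nhds_in_open tendstoD)
  then obtain d where d: "d > 0"
    "\<And>p. dist p z < d \<Longrightarrow> p \<in> S \<and> dist (D2f p v w) (D2f z v w) < e \<and> dist (D2f p w v) (D2f z w v) < e"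
    unfolding eventually_nhds_metric by auto
  \<comment> \<open>Keeps the parallelogram spanned by \<open>h *\<^sub>R v\<close> and
    \<open>h *\<^sub>R w\<close> inside the ball of radius \<open>d\<close>; the summand 1 makes the
    denominator positive and the estimate strict.\<close>
  define h where "h = d / (norm v + norm w + 1)"
  have pos: "norm v + norm w + 1 > 0"
    by (smt (verit) norm_ge_zero)
  then have "h > 0" using d by (simp add: h_def)
  have near: "dist (z + s *\<^sub>R a + t *\<^sub>R b) z < d"
    if "s \<in> {0..h}" "t \<in> {0..h}" "norm a + norm b = norm v + norm w" for s t a b
  proof -
    have "norm (s *\<^sub>R a + t *\<^sub>R b) \<le> s * norm a + t * norm b"
      using that norm_triangle_ineq[of "s *\<^sub>R a" "t *\<^sub>R b"] by simp
    also have "\<dots> \<le> h * norm a + h * norm b"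
      using that by (intro add_mono mult_right_mono) auto
    also have "\<dots> = h * (norm v + norm w)"
      using that by (metis distrib_left)
    also have "\<dots> < d"
      using \<open>h > 0\<close> pos by (simp add: h_def field_simps d)
    finally show ?thesis by (simp add: dist_norm add.assoc)
  qed
  obtain s t where 1: "s \<in> {0..h}" "t \<in> {0..h}"
    "f (z + h *\<^sub>R v + h *\<^sub>R w) - f (z + h *\<^sub>R v) - f (z + h *\<^sub>R w) + f z
       = h\<^sup>2 * D2f (z + s *\<^sub>R v + t *\<^sub>R w) w v"
    by (rule second_difference_mvt[where S = S and f = f and Df = Df and D2f = D2f,
          OF Df D2f \<open>h > 0\<close>, of z v w]) (use d near in auto)
  obtain s' t' where 2: "s' \<in> {0..h}" "t' \<in> {0..h}"
    "f (z + h *\<^sub>R w + h *\<^sub>R v) - f (z + h *\<^sub>R w) - f (z + h *\<^sub>R v) + f z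
       = h\<^sup>2 * D2f (z + s' *\<^sub>R w + t' *\<^sub>R v) v w"
    by (rule second_difference_mvt[where S = S and f = f and Df = Df and D2f = D2f,
          OF Df D2f \<open>h > 0\<close>, of z w v]) (use d near in \<open>auto simp: add.commute\<close>)
  have "D2f (z + s *\<^sub>R v + t *\<^sub>R w) w v = D2f (z + s' *\<^sub>R w + t' *\<^sub>R v) v w"
  proof -
    have swap: "z + h *\<^sub>R v + h *\<^sub>R w = z + h *\<^sub>R w + h *\<^sub>R v"
      by simp
    have "h\<^sup>2 * D2f (z + s *\<^sub>R v + t *\<^sub>R w) w v = h\<^sup>2 * D2f (z + s' *\<^sub>R w + t' *\<^sub>R v) v w"
      using 1(3)[unfolded swap] 2(3) by linarith
    then show ?thesis
      using \<open>h > 0\<close> by simp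
  qed
  moreover have "dist (D2f (z + s *\<^sub>R v + t *\<^sub>R w) w v) (D2f z w v) < e"
    using d(2) near[OF 1(1,2)] by blast
  moreover have "dist (D2f (z + s' *\<^sub>R w + t' *\<^sub>R v) v w) (D2f z v w) < e"
    using d(2) near[OF 2(1,2)] by (simp add: add.commute)
  ultimately show False
    unfolding e_def by (metis dist_triangle_half_r order_less_irrefl)
qed

section \<open>Harmonic functions as real parts of holomorphic functions\<close>

lemma harmonic_on_imp_Re_holomorphic:
  assumes u: "harmonic_on u S" and "convex S"
  obtains g where "g holomorphic_on S" "\<And>z. z \<in> S \<Longrightarrow> u z = Re (g z)"
proof (cases "S = {}")
  case False
  obtain Du :: "complex \<Rightarrow> complex \<Rightarrow>\<^sub>L real" and D2u :: "complex \<Rightarrow> complex \<Rightarrow>\<^sub>L complex \<Rightarrow>\<^sub>L real"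
    where "open S" and Du: "\<And>z. z \<in> S \<Longrightarrow> (u has_derivative Du z) (at z)"
      and D2u: "\<And>z. z \<in> S \<Longrightarrow> (Du has_derivative D2u z) (at z)"
      and cont: "continuous_on S D2u"
      and laplace: "\<And>z. z \<in> S \<Longrightarrow> D2u z 1 1 + D2u z \<i> \<i> = 0"
    using u unfolding harmonic_on_def by blast
  have sym: "D2u z v w = D2u z w v" if "z \<in> S" for z v w
    by (rule second_derivative_commute[OF Du D2u cont \<open>open S\<close> that])
  have lin: "A v = Re v *\<^sub>R A 1 + Im v *\<^sub>R A \<i>" for A :: "complex \<Rightarrow>\<^sub>L 'b::real_normed_vector" and v
  proof -
    have "v = Re v *\<^sub>R 1 + Im v *\<^sub>R \<i>"
      by (simp add: complex_eq_iff)
    then show ?thesis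
      by (metis blinfun.add_right blinfun.scaleR_right)
  qed
  \<comment> \<open>If \<open>u = Re g\<close>, then \<open>g' = u_x - i u_y\<close> by the
    Cauchy-Riemann equations, so \<open>h\<close> is the only candidate for
    \<open>g'\<close>.\<close>
  define h where "h z = complex_of_real (Du z 1) - \<i> * complex_of_real (Du z \<i>)" for z
  have h: "(h has_field_derivative (of_real (D2u z 1 1) - \<i> * of_real (D2u z 1 \<i>))) (at z)"
    if "z \<in> S" for z
  proof -
    have "(h has_derivative (\<lambda>v. of_real (D2u z v 1) - \<i> * of_real (D2u z v \<i>))) (at z)"
      unfolding h_def by (auto intro!: derivative_eq_intros D2u[OF that])
    \<comment> \<open>Complex linearity of the real differential of \<open>h\<close>: the Laplace
      equation gives one Cauchy-Riemann equation, symmetry of the mixed derivatives the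
      other.\<close>
    moreover have "(\<lambda>v. of_real (D2u z v 1) - \<i> * of_real (D2u z v \<i>)) =
        (*) (of_real (D2u z 1 1) - \<i> * of_real (D2u z 1 \<i>))"
    proof
      fix v
      have "D2u z v x = Re v * D2u z 1 x + Im v * D2u z \<i> x" for x
        by (subst lin) (simp add: blinfun.add_left blinfun.scaleR_left)
      moreover have "D2u z \<i> \<i> = - D2u z 1 1"
        using laplace[OF that] by simp
      moreover have "D2u z \<i> 1 = D2u z 1 \<i>"
        by (rule sym[OF that])
      ultimately show "complex_of_real (D2u z v 1) - \<i> * of_real (D2u z v \<i>) =
          (of_real (D2u z 1 1) - \<i> * of_real (D2u z 1 \<i>)) * v"
        by (simp add: complex_eq_iff mult_ac del: of_real_add of_real_mult)
    qed
    ultimately show ?thesis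
      by (simp only: has_field_derivative_def)
  qed
  then have "h holomorphic_on S"
    using \<open>open S\<close> holomorphic_on_open by blast
  then obtain g where g: "\<And>z. z \<in> S \<Longrightarrow> (g has_field_derivative h z) (at z within S)"
    using holomorphic_convex_primitive'[OF \<open>convex S\<close> \<open>open S\<close>] by metis
  \<comment> \<open>The primitive determines \<open>u\<close> only up to a real constant, which is
    added to \<open>g\<close> at the end.\<close>
  have "((\<lambda>z. u z - Re (g z)) has_derivative (\<lambda>v. 0)) (at z within S)" if "z \<in> S" for z
  proof -
    have "((\<lambda>z. u z - Re (g z)) has_derivative (\<lambda>v. Du z v - Re (h z * v))) (at z within S)"
      using has_derivative_at_withinI[OF Du[OF that], of S] g[OF that, unfolded has_field_derivative_def]
      by (auto intro!: derivative_eq_intros)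
    moreover have "Du z v - Re (h z * v) = 0" for v
      using lin[of "Du z" v] by (simp add: h_def algebra_simps)
    ultimately show ?thesis by simp
  qed
  then obtain c where c: "\<And>z. z \<in> S \<Longrightarrow> u z - Re (g z) = c"
    using has_derivative_zero_constant[OF \<open>convex S\<close>, of "\<lambda>z. u z - Re (g z)"] by auto
  show ?thesis
  proof
    show "(\<lambda>z. g z + of_real c) holomorphic_on S"
      using g by (intro holomorphic_intros) (auto simp: holomorphic_on_def field_differentiable_def)
    show "u z = Re (g z + of_real c)" if "z \<in> S" for z
      using c[OF that] by simp
  qed
qed (use that[of "\<lambda>_. 0"] in auto)

text \<open>The first and second differentials are \<open>v \<mapsto> Re (g' v)\<close> and
  \<open>(v, w) \<mapsto> Re (g'' v w)\<close>, and the Laplacian vanishes because 1 and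
  \<open>\<i>\<close> have squares 1 and -1. \<open>L\<close> and \<open>D2\<close> package these
  forms as bounded linear functions of their coefficient, so that differentiability and continuity
  carry over from \<open>g'\<close> and \<open>g''\<close>.\<close>

lemma harmonic_on_Re:
  assumes "g holomorphic_on S" "open S"
  shows "harmonic_on (\<lambda>z. Re (g z)) S"
  unfolding harmonic_on_def
proof (intro conjI exI ballI)
  define L :: "complex \<Rightarrow> complex \<Rightarrow>\<^sub>L real" where "L c = Blinfun Re o\<^sub>L blinfun_mult_right c" for c
  have L: "L c v = Re (c * v)" for c v
    by (simp add: L_def bounded_linear_Blinfun_apply[OF bounded_linear_Re])
  have "bounded_linear L"
    unfolding L_def by (intro bounded_linear_intros)
  define D2 :: "complex \<Rightarrow> complex \<Rightarrow>\<^sub>L complex \<Rightarrow>\<^sub>L real"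
    where "D2 c = Blinfun L o\<^sub>L blinfun_mult_right c" for c
  have D2: "D2 c v = L (c * v)" for c v
    by (simp add: D2_def bounded_linear_Blinfun_apply[OF \<open>bounded_linear L\<close>])
  have "bounded_linear D2"
    unfolding D2_def by (intro bounded_linear_intros)
  note holo = holomorphic_deriv[OF assms]
  show "((\<lambda>z. Re (g z)) has_derivative L (deriv g z)) (at z)" if "z \<in> S" for z
    using holomorphic_derivI[OF assms that]
    by (auto intro!: derivative_eq_intros simp: has_field_derivative_def L)
  show "((\<lambda>z. L (deriv g z)) has_derivative D2 (deriv (deriv g) z)) (at z)" if "z \<in> S" for z
    using bounded_linear.has_derivative[OF \<open>bounded_linear L\<close>
        holomorphic_derivI[OF holo \<open>open S\<close> that, unfolded has_field_derivative_def]]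
    by (simp add: D2[abs_def])
  show "continuous_on S (\<lambda>z. D2 (deriv (deriv g) z))"
    using holomorphic_on_imp_continuous_on[OF holomorphic_deriv[OF holo \<open>open S\<close>]]
    by (intro bounded_linear.continuous_on[OF \<open>bounded_linear D2\<close>])
  show "D2 (deriv (deriv g) z) 1 1 + D2 (deriv (deriv g) z) \<i> \<i> = 0" for z
    by (simp add: D2 L)
qed (fact assms)

section \<open>The Schwarz lemma for the strip and for complex harmonic functions\<close>

text \<open>The squared norms of \<open>E + 1\<close> and \<open>E - 1\<close> differ by
  \<open>4 * Re E\<close>. One direction sends the strip into the disc, the other bounds the real
  part of \<open>Arctan\<close>.\<close>

lemma norm_cayley_less_1_iff: "norm ((E - 1) / (E + 1)) < 1 \<longleftrightarrow> Re E > 0" if "E \<noteq> - 1" for E :: complex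
proof -
  have "E + 1 \<noteq> 0"
    using that by (simp add: eq_neg_iff_add_eq_0)
  then have "norm ((E - 1) / (E + 1)) < 1 \<longleftrightarrow> norm (E - 1) < norm (E + 1)"
    by (simp add: norm_divide)
  also have "\<dots> \<longleftrightarrow> (norm (E - 1))\<^sup>2 < (norm (E + 1))\<^sup>2"
    by (metis linorder_not_le norm_ge_zero pos2 power_mono_iff)
  also have "\<dots> \<longleftrightarrow> Re E > 0"
    unfolding cmod_power2 by (simp add: power2_eq_square algebra_simps)
  finally show ?thesis .
qed

lemma schwarz_strip:
  assumes g: "g holomorphic_on ball 0 1" and re: "\<And>z. norm z < 1 \<Longrightarrow> \<bar>Re (g z)\<bar> < 1"
    and "Re (g 0) = 0"
  shows "norm (deriv g 0) \<le> 4 / pi"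
proof -
  \<comment> \<open>Subtracting \<open>g 0\<close>, which is purely imaginary, normalises
    \<open>E 0 = 1\<close> and leaves the real part of \<open>g\<close> unchanged.\<close>
  define E where "E z = exp (\<i> * of_real (pi / 2) * (g z - g 0))" for z
  define \<phi> where "\<phi> z = (E z - 1) / (E z + 1)" for z
  have pos: "Re (E z) > 0" if "norm z < 1" for z
  proof -
    have "\<bar>pi / 2 * Re (g z)\<bar> < pi / 2"
      using re[OF that] by (simp add: abs_mult)
    then have "cos (pi / 2 * Re (g z)) > 0"
      by (intro cos_gt_zero_pi) (auto simp: abs_less_iff)
    then show ?thesis
      using assms(3) by (simp add: E_def Re_exp)
  qed
  have nz: "E z + 1 \<noteq> 0" if "norm z < 1" for z
    using pos[OF that] by (auto simp: complex_eq_iff)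
  have "\<phi> holomorphic_on ball 0 1"
    unfolding \<phi>_def using nz by (auto intro!: holomorphic_intros g simp: E_def)
  moreover have "norm (\<phi> z) < 1" if "norm z < 1" for z
    using norm_cayley_less_1_iff[of "E z"] pos[OF that] nz[OF that]
    by (simp add: \<phi>_def eq_neg_iff_add_eq_0)
  moreover have "\<phi> 0 = 0"
    by (simp add: \<phi>_def E_def)
  ultimately have "norm (deriv \<phi> 0) \<le> 1"
    using Schwarz_Lemma(2)[of \<phi> 0] by simp
  \<comment> \<open>The Cayley map has derivative 1/2 at \<open>E 0 = 1\<close>, which turns the
    factor \<open>pi / 2\<close> into \<open>pi / 4\<close>.\<close>
  moreover have "deriv \<phi> 0 = \<i> * of_real (pi / 4) * deriv g 0"
  proof -
    have "E 0 = 1"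
      by (simp add: E_def)
    have "(g has_field_derivative deriv g 0) (at 0)"
      using holomorphic_derivI[OF g, of 0] by simp
    then have "(E has_field_derivative \<i> * of_real (pi / 2) * deriv g 0) (at 0)"
      unfolding E_def by (auto intro!: derivative_eq_intros)
    then have "(\<phi> has_field_derivative \<i> * of_real (pi / 4) * deriv g 0) (at 0)"
      unfolding \<phi>_def using \<open>E 0 = 1\<close> by (auto intro!: derivative_eq_intros)
    then show ?thesis
      by (rule DERIV_imp_deriv)
  qed
  ultimately show ?thesis
    by (simp add: norm_mult field_simps)
qed

lemma harmonic_disc_derivative_bound:
  fixes u w :: "complex \<Rightarrow> real"
  assumes u: "harmonic_on u (ball 0 1)" and w: "harmonic_on w (ball 0 1)"
    and bound: "\<And>z. norm z < 1 \<Longrightarrow> norm (Complex (u z) (w z)) < 1"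
    and "u 0 = 0" "w 0 = 0"
  obtains u' w' where "(u has_derivative u') (at 0)" "(w has_derivative w') (at 0)"
    "\<And>v. norm (Complex (u' v) (w' v)) \<le> 4 / pi * norm v"
proof -
  obtain g where g: "g holomorphic_on ball 0 1" "\<And>z. z \<in> ball 0 1 \<Longrightarrow> u z = Re (g z)"
    using harmonic_on_imp_Re_holomorphic[OF u convex_ball] by blast
  obtain k where k: "k holomorphic_on ball 0 1" "\<And>z. z \<in> ball 0 1 \<Longrightarrow> w z = Re (k z)"
    using harmonic_on_imp_Re_holomorphic[OF w convex_ball] by blast
  define u' where "u' v = Re (deriv g 0 * v)" for v
  define w' where "w' v = Re (deriv k 0 * v)" for v
  have Re_deriv: "(x has_derivative (\<lambda>v. Re (deriv f 0 * v))) (at 0)"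
    if "f holomorphic_on ball 0 1" "\<And>z. z \<in> ball 0 1 \<Longrightarrow> x z = Re (f z)" for f and x :: "complex \<Rightarrow> real"
  proof -
    have "((\<lambda>z. Re (f z)) has_derivative (\<lambda>v. Re (deriv f 0 * v))) (at 0)"
      using holomorphic_derivI[OF that(1), of 0]
      by (auto intro!: derivative_eq_intros simp: has_field_derivative_def)
    then show ?thesis
      using has_derivative_transform_within_open[of _ _ 0 UNIV "ball 0 1" x] that(2) by auto
  qed
  show ?thesis
  proof
    show "(u has_derivative u') (at 0)" "(w has_derivative w') (at 0)"
      unfolding u'_def w'_def using Re_deriv g k by blast+
    fix v
    define r where "r = norm (Complex (u' v) (w' v))"
    \<comment> \<open>\<open>\<alpha> - \<i> \<beta>\<close> is the rotation that makes the
      differential in the fixed direction \<open>v\<close> equal to \<open>r\<close>. The value 1, 0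
      for \<open>r = 0\<close> keeps it a unit.\<close>
    define \<alpha> \<beta> where "\<alpha> = (if r = 0 then 1 else u' v / r)" and "\<beta> = (if r = 0 then 0 else w' v / r)"
    have r2: "r\<^sup>2 = (u' v)\<^sup>2 + (w' v)\<^sup>2"
      by (simp add: r_def cmod_power2)
    have unit: "\<alpha>\<^sup>2 + \<beta>\<^sup>2 = 1"
      using r2 by (auto simp: \<alpha>_def \<beta>_def power_divide simp flip: add_divide_distrib)
    have r: "r = \<alpha> * u' v + \<beta> * w' v"
      using r2 by (auto simp: \<alpha>_def \<beta>_def field_simps power2_eq_square)
    \<comment> \<open>A real combination of \<open>g\<close> and \<open>k\<close> is again
      holomorphic, and its real part is that of the rotated function, hence below 1 in absolute
      value.\<close>
    define q where "q z = of_real \<alpha> * g z + of_real \<beta> * k z" for z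
    have "norm (deriv q 0) \<le> 4 / pi"
    proof (rule schwarz_strip)
      show "q holomorphic_on ball 0 1"
        unfolding q_def by (intro holomorphic_intros g k)
      show "Re (q 0) = 0"
        using g(2)[of 0] k(2)[of 0] assms(4,5) by (simp add: q_def)
      show "\<bar>Re (q z)\<bar> < 1" if "norm z < 1" for z
      proof -
        have "Re (q z) = \<alpha> * u z + \<beta> * w z"
          using g(2)[of z] k(2)[of z] that by (simp add: q_def)
        also have "\<dots> = Re (Complex \<alpha> (-\<beta>) * Complex (u z) (w z))"
          by simp
        also have "\<bar>\<dots>\<bar> \<le> norm (Complex \<alpha> (-\<beta>)) * norm (Complex (u z) (w z))"
          by (metis abs_Re_le_cmod norm_mult)
        also have "norm (Complex \<alpha> (-\<beta>)) = 1"
          using unit by (simp add: cmod_def)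
        finally show ?thesis
          using bound[OF that] by simp
      qed
    qed
    moreover have "deriv q 0 = of_real \<alpha> * deriv g 0 + of_real \<beta> * deriv k 0"
      unfolding q_def
      by (rule DERIV_imp_deriv)
        (use holomorphic_derivI[OF g(1), of 0] holomorphic_derivI[OF k(1), of 0] in
          \<open>auto intro!: derivative_eq_intros\<close>)
    ultimately have "norm (of_real \<alpha> * deriv g 0 + of_real \<beta> * deriv k 0) \<le> 4 / pi"
      by simp
    moreover have "r = Re ((of_real \<alpha> * deriv g 0 + of_real \<beta> * deriv k 0) * v)"
      by (simp add: r u'_def w'_def algebra_simps)
    ultimately show "norm (Complex (u' v) (w' v)) \<le> 4 / pi * norm v"
      unfolding r_def[symmetric]
      by (smt (verit) complex_Re_le_cmod mult_right_mono norm_ge_zero norm_mult)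
  qed
qed

section \<open>Vector-valued maps and the upper bound\<close>

lemma has_derivative_complex_vec:
  fixes F :: "'a::real_normed_vector \<Rightarrow> complex ^ 'n"
  assumes "\<And>i. ((\<lambda>z. Re (F z $ i)) has_derivative u i) (at x)"
    and "\<And>i. ((\<lambda>z. Im (F z $ i)) has_derivative w i) (at x)"
  shows "(F has_derivative (\<lambda>v. \<chi> i. Complex (u i v) (w i v))) (at x)"
  unfolding has_derivative_componentwise_within[of F]
  using assms by (auto simp: Basis_vec_def inner_axis Basis_complex_def inner_complex_def)

lemma norm_vec_le_sqrt_card:
  fixes x :: "'a::real_normed_vector ^ 'n"
  assumes "\<And>i. norm (x $ i) \<le> K"
  shows "norm x \<le> sqrt (real CARD('n)) * K"
proof -
  have "K \<ge> 0"
    using assms norm_ge_zero order_trans by blast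
  have "norm x \<le> L2_set (\<lambda>i::'n. K) UNIV"
    unfolding norm_vec_def using assms by (intro L2_set_mono) auto
  also have "\<dots> = sqrt (real CARD('n)) * K"
    using \<open>K \<ge> 0\<close> by (simp add: L2_set_def real_sqrt_mult)
  finally show ?thesis .
qed

lemma onorm_derivative_le:
  fixes F :: "complex \<Rightarrow> complex ^ 'n"
  assumes "F \<in> centred_harmonic_maps"
  shows "onorm (frechet_derivative F (at 0)) \<le> 4 * sqrt (real CARD('n)) / pi"
proof -
  have "\<exists>u' w'. ((\<lambda>z. Re (F z $ i)) has_derivative u') (at 0) \<and>
      ((\<lambda>z. Im (F z $ i)) has_derivative w') (at 0) \<and>
      (\<forall>v. norm (Complex (u' v) (w' v)) \<le> 4 / pi * norm v)" for i
  proof -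
    have "norm (F z $ i) < 1" if "norm z < 1" for z
      using assms that by (auto simp: centred_harmonic_maps_def polydisc_def image_subset_iff)
    then show ?thesis
      using assms harmonic_disc_derivative_bound[of "\<lambda>z. Re (F z $ i)" "\<lambda>z. Im (F z $ i)"]
      by (simp add: centred_harmonic_maps_def harmonic_map_on_def) metis
  qed
  then obtain u' w' where "\<And>i. ((\<lambda>z. Re (F z $ i)) has_derivative u' i) (at 0)"
    "\<And>i. ((\<lambda>z. Im (F z $ i)) has_derivative w' i) (at 0)"
    and b: "\<And>i v. norm (Complex (u' i v) (w' i v)) \<le> 4 / pi * norm v"
    by metis
  then have "(F has_derivative (\<lambda>v. \<chi> i. Complex (u' i v) (w' i v))) (at 0)"
    by (intro has_derivative_complex_vec)
  \<comment> \<open>\<open>frechet_derivative\<close> is a choice operator; uniqueness of the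
    derivative identifies it with the computed one.\<close>
  then have "frechet_derivative F (at 0) = (\<lambda>v. \<chi> i. Complex (u' i v) (w' i v))"
    by (rule frechet_derivative_at[symmetric])
  moreover have "norm (\<chi> i::'n. Complex (u' i v) (w' i v)) \<le> 4 * sqrt (real CARD('n)) / pi * norm v" for v
    using norm_vec_le_sqrt_card[of "\<chi> i::'n. Complex (u' i v) (w' i v)" "4 / pi * norm v"] b
    by (simp add: mult_ac)
  ultimately show ?thesis
    by (intro onorm_le) simp
qed

section \<open>The extremal map\<close>

text \<open>\<open>Arctan z\<close> is \<open>\<i> / 2 * Ln E\<close>, so its real part is minus
  half the argument of \<open>E\<close>. Since \<open>(E - 1) / (E + 1) = - \<i> * z\<close> lies in
  the disc, \<open>E\<close> lies in the right half-plane.\<close>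

lemma Re_Arctan_less_quarter_pi:
  assumes "norm z < 1"
  shows "\<bar>Re (Arctan z)\<bar> < pi / 4"
proof -
  define E where "E = (1 - \<i> * z) / (1 + \<i> * z)"
  have nz: "1 + \<i> * z \<noteq> 0"
    using assms by (metis add_eq_0_iff norm_ii norm_minus_cancel norm_mult norm_one mult_1 order_less_irrefl)
  have "E + 1 = 2 / (1 + \<i> * z)" "E - 1 = - 2 * \<i> * z / (1 + \<i> * z)"
    using nz by (simp_all add: E_def field_simps)
  then have "E + 1 \<noteq> 0" "norm ((E - 1) / (E + 1)) < 1"
    using nz assms by (simp_all add: norm_divide norm_mult)
  then have "Re E > 0"
    using norm_cayley_less_1_iff[of E] by (simp add: eq_neg_iff_add_eq_0)
  then have "\<bar>Im (Ln E)\<bar> < pi / 2"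
    by (rule Re_Ln_pos_lt_imp)
  then show ?thesis
    by (simp add: Arctan_def E_def)
qed

definition arctan_map :: "complex \<Rightarrow> complex ^ 'n" where
  "arctan_map z = (\<chi> i. of_real (Re (of_real (4 / pi) * Arctan z)))"

lemma arctan_map_centred: "arctan_map \<in> centred_harmonic_maps"
proof -
  have "(\<lambda>z. of_real (4 / pi) * Arctan z) holomorphic_on ball 0 1"
    by (intro holomorphic_intros holomorphic_on_Arctan)
      (auto intro: le_less_trans[OF abs_Im_le_cmod])
  then have "harmonic_on (\<lambda>z. Re (of_real (4 / pi) * Arctan z)) (ball 0 1)"
    by (rule harmonic_on_Re) simp
  moreover have "harmonic_on (\<lambda>z. 0) (ball 0 1)"
    using harmonic_on_Re[of "\<lambda>_. 0" "ball 0 1"] by simp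
  moreover have "norm (complex_of_real (Re (of_real (4 / pi) * Arctan z))) < 1" if "norm z < 1" for z
    using Re_Arctan_less_quarter_pi[OF that] unfolding norm_of_real by (simp add: abs_mult field_simps)
  ultimately show ?thesis
    by (auto simp: centred_harmonic_maps_def harmonic_map_on_def polydisc_def arctan_map_def vec_eq_iff
        simp del: of_real_divide times_complex.sel norm_of_real)
qed

text \<open>\<open>Arctan\<close> has derivative 1 at 0, so all components are stretched by
  \<open>4 / pi\<close> in the same direction 1, and n equal components contribute the factor sqrt
  n.\<close>

lemma onorm_derivative_arctan_map:
  "onorm (frechet_derivative (arctan_map :: complex \<Rightarrow> complex ^ 'n) (at 0)) \<ge> 4 * sqrt (real CARD('n)) / pi"
proof -
  define A :: "complex \<Rightarrow> complex ^ 'n" where "A v = (\<chi> i. Complex (4 / pi * Re v) 0)" for v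
  have "((\<lambda>z. Re (of_real (4 / pi) * Arctan z)) has_derivative (\<lambda>v. 4 / pi * Re v)) (at 0)"
    using has_field_derivative_Arctan[of 0]
    by (auto intro!: derivative_eq_intros simp: has_field_derivative_def)
  then have A: "(arctan_map has_derivative A) (at 0)"
    unfolding A_def by (intro has_derivative_complex_vec) (simp_all add: arctan_map_def)
  have "norm (A 1) = 4 * sqrt (real CARD('n)) / pi"
    by (simp add: A_def norm_vec_def L2_set_def real_sqrt_mult cmod_def)
  moreover have "norm (A 1) \<le> onorm A * norm (1::complex)"
    by (rule onorm[OF has_derivative_bounded_linear[OF A]])
  ultimately show ?thesis
    using frechet_derivative_at[OF A] by simp
qed

theorem corollary11p3:
  shows "(\<forall>F \<in> (centred_harmonic_maps :: (complex \<Rightarrow> complex ^ 'n) set).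
            onorm (frechet_derivative F (at 0)) \<le> 4 * sqrt (real CARD('n)) / pi) \<and>
         (SUP F \<in> (centred_harmonic_maps :: (complex \<Rightarrow> complex ^ 'n) set).
            onorm (frechet_derivative F (at 0))) = 4 * sqrt (real CARD('n)) / pi"
proof (intro conjI ballI)
  show le: "onorm (frechet_derivative F (at 0)) \<le> 4 * sqrt (real CARD('n)) / pi"
    if "F \<in> centred_harmonic_maps" for F :: "complex \<Rightarrow> complex ^ 'n"
    using that by (rule onorm_derivative_le)
  have "onorm (frechet_derivative (arctan_map :: complex \<Rightarrow> complex ^ 'n) (at 0)) = 4 * sqrt (real CARD('n)) / pi"
    using le[OF arctan_map_centred] onorm_derivative_arctan_map by (rule order_antisym)
  then show "(SUP F \<in> (centred_harmonic_maps :: (complex \<Rightarrow> complex ^ 'n) set).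
            onorm (frechet_derivative F (at 0))) = 4 * sqrt (real CARD('n)) / pi"
    \<comment> \<open>The bound is attained, so the supremum is a maximum.\<close>
    using arctan_map_centred le by (intro cSup_eq_maximum) (auto intro: rev_image_eqI)
qed

end
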